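(* The Fréchet ${}^*$-algebra $A^\infty(\mathbb{D})$ of holomorphic functions on the open unit disc that are smooth up to the boundary is not isomorphic (as a Fréchet ${}^*$-algebra) to any closed ${}^*$-subalgebra of $\mathscr{L}^*(s)$.
   Context: $\mathbb{D}$ is the open unit disc in $\mathbb{C}$ and $A(\mathbb{D})$ is the disc algebra (holomorphic functions on $\mathbb{D}$ extending continuously to $\overline{\mathbb{D}}$). $A^\infty(\mathbb{D})=\{f\in A(\mathbb{D}):f^{(k)}\in A(\mathbb{D})\text{ for all }k\in\mathbb{N}\}$, with the Fréchet topology given by the norms $\|f\|_p=\sup\{|f^{(j)}(z)|:z\in\mathbb{D},0\le j\le p\}$, $p\in\mathbb{N}_0$, pointwise multiplication and the involution $f^*(z)=\overline{f(\overline z)}$. An isomorphism of Fréchet ${}^*$-algebras is a ${}^*$-algebra isomorphism that is a homeomorphism; a subalgebra carries the subspace topology. The algebra $\mathscr{L}^*(s)$: $s=\{\xi\in\mathbb{C}^{\mathbb{N}}:|\xi|_q^2=\sum_j|\xi_j|^2j^{2q}<\infty\text{ for all }q\in\mathbb{N}_0\}$ with the Fréchet topology given by the norms $|\cdot|_q$; it is a dense subspace of $\ell_2$. $\mathscr{L}^*(s)$ is the set of all linear maps $x\colon s\to s$ such that, regarding $x$ as an unbounded operator in $\ell_2$ with domain $s$, its Hilbert space adjoint $x^*$ satisfies $s\subset\mathscr{D}(x^* )$ and $x^*(s)\subset s$. It is a ${}^*$-algebra under composition with involution $x\mapsto x^*|_s$ (again written $x^*$). Its topology $\tau^*$ is the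 locally convex topology given by the seminorms $p_{N,B}(x)=\max\{\sup_{\xi\in B}|x\xi|_N,\sup_{\xi\in B}|x^*\xi|_N\}$, where $N\in\mathbb{N}_0$ and $B$ runs over the bounded subsets of $s$. *)

theory Defs
  imports "HOL-Complex_Analysis.Complex_Analysis" "HOL-Library.FuncSet"
begin

record 'a top_star_algebra =
  alg_carrier :: "'a set"
  alg_add :: "'a \<Rightarrow> 'a \<Rightarrow> 'a"
  alg_scale :: "complex \<Rightarrow> 'a \<Rightarrow> 'a"
  alg_mult :: "'a \<Rightarrow> 'a \<Rightarrow> 'a"
  alg_star :: "'a \<Rightarrow> 'a"
  alg_topology :: "'a topology"

definition star_subalgebra :: "'a set \<Rightarrow> 'a top_star_algebra \<Rightarrow> bool" where
  "star_subalgebra B A \<longleftrightarrow>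
     B \<subseteq> alg_carrier A \<and> B \<noteq> {} \<and>
     (\<forall>x\<in>B. \<forall>y\<in>B. alg_add A x y \<in> B) \<and>
     (\<forall>c. \<forall>x\<in>B. alg_scale A c x \<in> B) \<and>
     (\<forall>x\<in>B. \<forall>y\<in>B. alg_mult A x y \<in> B) \<and>
     (\<forall>x\<in>B. alg_star A x \<in> B)"

definition closed_star_subalgebra :: "'a set \<Rightarrow> 'a top_star_algebra \<Rightarrow> bool" where
  "closed_star_subalgebra B A \<longleftrightarrow> star_subalgebra B A \<and> closedin (alg_topology A) B"

definition sub_top_star_algebra :: "'a top_star_algebra \<Rightarrow> 'a set \<Rightarrow> 'a top_star_algebra" where
  "sub_top_star_algebra A B =
     A\<lparr>alg_carrier := B, alg_topology := subtopology (alg_topology A) B\<rparr>"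

definition top_star_algebra_iso ::
    "'a top_star_algebra \<Rightarrow> 'b top_star_algebra \<Rightarrow> ('a \<Rightarrow> 'b) \<Rightarrow> bool" where
  "top_star_algebra_iso A B \<phi> \<longleftrightarrow>
     bij_betw \<phi> (alg_carrier A) (alg_carrier B) \<and>
     (\<forall>x\<in>alg_carrier A. \<forall>y\<in>alg_carrier A. \<phi> (alg_add A x y) = alg_add B (\<phi> x) (\<phi> y)) \<and>
     (\<forall>c. \<forall>x\<in>alg_carrier A. \<phi> (alg_scale A c x) = alg_scale B c (\<phi> x)) \<and>
     (\<forall>x\<in>alg_carrier A. \<forall>y\<in>alg_carrier A. \<phi> (alg_mult A x y) = alg_mult B (\<phi> x) (\<phi> y)) \<and>
     (\<forall>x\<in>alg_carrier A. \<phi> (alg_star A x) = alg_star B (\<phi> x)) \<and>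
     homeomorphic_map (alg_topology A) (alg_topology B) \<phi>"

definition isomorphic_top_star_algebras ::
    "'a top_star_algebra \<Rightarrow> 'b top_star_algebra \<Rightarrow> bool" where
  "isomorphic_top_star_algebras A B \<longleftrightarrow> (\<exists>\<phi>. top_star_algebra_iso A B \<phi>)"

text \<open>The locally convex topology on the carrier \<open>V\<close>, with subtraction \<open>d\<close>, given by a family
  \<open>P\<close> of seminorms: the open balls of all the seminorms, around all points, form a subbase.
  Seminorms take values in \<^typ>\<open>ennreal\<close> so that suprema never have to be shown finite
  in order to be meaningful (and the supremum over the empty set is 0).\<close>

definition seminorm_topology ::
    "'a set \<Rightarrow> ('a \<Rightarrow> 'a \<Rightarrow> 'a) \<Rightarrow> ('a \<Rightarrow> ennreal) set \<Rightarrow> 'a topology" where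
  "seminorm_topology V d P =
     topology_generated_by
       {{y \<in> V. p (d y x) < ennreal e} | x p e. x \<in> V \<and> p \<in> P \<and> e > 0}"

lemma topspace_seminorm_topology:
  assumes "P \<noteq> {}" and "\<And>x p. x \<in> V \<Longrightarrow> p \<in> P \<Longrightarrow> p (d x x) = 0"
  shows "topspace (seminorm_topology V d P) = V"
proof -
  obtain p where "p \<in> P" using assms(1) by blast
  then have "x \<in> {y \<in> V. p (d y x) < ennreal 1}" if "x \<in> V" for x
    using assms(2)[OF that \<open>p \<in> P\<close>] that by simp
  then show ?thesis
    unfolding seminorm_topology_def topology_generated_by_topspace
    using \<open>p \<in> P\<close> zero_less_one by blast
qed

text \<open>Elements of the algebra are functions on the open disc, represented as functions on
  \<^typ>\<open>complex\<close> that are \<^const>\<open>undefined\<close> elsewhere; membership of a (derivative of a) function in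
  the disc algebra only looks at its values on the open disc.\<close>

abbreviation unit_disc :: "complex set" where
  "unit_disc \<equiv> ball 0 1"

definition in_disc_algebra :: "(complex \<Rightarrow> complex) \<Rightarrow> bool" where
  "in_disc_algebra f \<longleftrightarrow> f holomorphic_on unit_disc \<and>
     (\<exists>g. continuous_on (closure unit_disc) g \<and> (\<forall>z\<in>unit_disc. g z = f z))"

definition A_infty_carrier :: "(complex \<Rightarrow> complex) set" where
  "A_infty_carrier = {f \<in> extensional unit_disc. \<forall>k. in_disc_algebra ((deriv ^^ k) f)}"

definition A_infty_norm :: "nat \<Rightarrow> (complex \<Rightarrow> complex) \<Rightarrow> ennreal" where
  "A_infty_norm p f = Sup {ennreal (cmod ((deriv ^^ j) f z)) | z j. z \<in> unit_disc \<and> j \<le> p}"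

definition A_infty :: "(complex \<Rightarrow> complex) top_star_algebra" where
  "A_infty = \<lparr>
     alg_carrier = A_infty_carrier,
     alg_add = (\<lambda>f g. \<lambda>z\<in>unit_disc. f z + g z),
     alg_scale = (\<lambda>c f. \<lambda>z\<in>unit_disc. c * f z),
     alg_mult = (\<lambda>f g. \<lambda>z\<in>unit_disc. f z * g z),
     alg_star = (\<lambda>f. \<lambda>z\<in>unit_disc. cnj (f (cnj z))),
     alg_topology =
       seminorm_topology A_infty_carrier (\<lambda>f g. \<lambda>z\<in>unit_disc. f z - g z) (range A_infty_norm)\<rparr>"

text \<open>Sequences are indexed by the positive integers in the definition of the space \<open>s\<close>; here
  \<open>\<xi> j\<close> is the entry with index \<open>Suc j\<close>, so its weight is a power of \<open>Suc j\<close>.\<close>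

definition ell2 :: "(nat \<Rightarrow> complex) set" where
  "ell2 = {\<xi>. summable (\<lambda>j. (cmod (\<xi> j))\<^sup>2)}"

definition ell2_inner :: "(nat \<Rightarrow> complex) \<Rightarrow> (nat \<Rightarrow> complex) \<Rightarrow> complex" where
  "ell2_inner \<xi> \<eta> = (\<Sum>j. \<xi> j * cnj (\<eta> j))"

definition s_space :: "(nat \<Rightarrow> complex) set" where
  "s_space = {\<xi>. \<forall>q::nat. summable (\<lambda>j. (cmod (\<xi> j))\<^sup>2 * real (Suc j) ^ (2 * q))}"

definition s_norm :: "nat \<Rightarrow> (nat \<Rightarrow> complex) \<Rightarrow> real" where
  "s_norm q \<xi> = sqrt (\<Sum>j. (cmod (\<xi> j))\<^sup>2 * real (Suc j) ^ (2 * q))"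

definition s_bounded :: "(nat \<Rightarrow> complex) set \<Rightarrow> bool" where
  "s_bounded B \<longleftrightarrow> B \<subseteq> s_space \<and> (\<forall>q. \<exists>C. \<forall>\<xi>\<in>B. s_norm q \<xi> \<le> C)"

text \<open>Operators on \<open>s\<close> are represented as functions that are \<^const>\<open>undefined\<close> outside \<open>s\<close>.\<close>

definition s_operator :: "((nat \<Rightarrow> complex) \<Rightarrow> (nat \<Rightarrow> complex)) \<Rightarrow> bool" where
  "s_operator x \<longleftrightarrow> x \<in> s_space \<rightarrow>\<^sub>E s_space \<and>
     (\<forall>\<xi>\<in>s_space. \<forall>\<eta>\<in>s_space. x (\<lambda>j. \<xi> j + \<eta> j) = (\<lambda>j. x \<xi> j + x \<eta> j)) \<and>
     (\<forall>c. \<forall>\<xi>\<in>s_space. x (\<lambda>j. c * \<xi> j) = (\<lambda>j. c * x \<xi> j))"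

text \<open>\<open>\<zeta>\<close> is the value at \<open>\<eta>\<close> of the Hilbert space adjoint of \<open>x\<close>, an unbounded operator in \<open>\<ell>\<^sub>2\<close>
  with domain \<open>s\<close>; it is unique because \<open>s\<close> is dense.\<close>

definition is_adjoint_value ::
    "((nat \<Rightarrow> complex) \<Rightarrow> (nat \<Rightarrow> complex)) \<Rightarrow> (nat \<Rightarrow> complex) \<Rightarrow> (nat \<Rightarrow> complex) \<Rightarrow> bool" where
  "is_adjoint_value x \<eta> \<zeta> \<longleftrightarrow>
     \<zeta> \<in> ell2 \<and> (\<forall>\<xi>\<in>s_space. ell2_inner (x \<xi>) \<eta> = ell2_inner \<xi> \<zeta>)"

definition adjoint_domain ::
    "((nat \<Rightarrow> complex) \<Rightarrow> (nat \<Rightarrow> complex)) \<Rightarrow> (nat \<Rightarrow> complex) set" where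
  "adjoint_domain x = {\<eta> \<in> ell2. \<exists>\<zeta>. is_adjoint_value x \<eta> \<zeta>}"

definition hilbert_adjoint ::
    "((nat \<Rightarrow> complex) \<Rightarrow> (nat \<Rightarrow> complex)) \<Rightarrow> (nat \<Rightarrow> complex) \<Rightarrow> (nat \<Rightarrow> complex)" where
  "hilbert_adjoint x \<eta> = (THE \<zeta>. is_adjoint_value x \<eta> \<zeta>)"

lemma is_adjoint_value_unique:
  assumes "is_adjoint_value x \<eta> \<zeta>" "is_adjoint_value x \<eta> \<zeta>'"
  shows "\<zeta> = \<zeta>'"
proof
  fix k
  define e :: "nat \<Rightarrow> complex" where "e = (\<lambda>j. if j = k then 1 else 0)"
  have inner: "ell2_inner e v = cnj (v k)" for v
  proof -
    have "(\<lambda>j. e j * cnj (v j)) = (\<lambda>j. if j = k then cnj (v j) else 0)"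
      by (auto simp: e_def)
    then show ?thesis
      using sums_If_finite_set[of "{k}" "\<lambda>j. cnj (v j)"]
      by (simp add: ell2_inner_def sums_iff)
  qed
  have "e \<in> s_space"
    unfolding s_space_def
  proof (intro CollectI allI)
    fix q :: nat
    show "summable (\<lambda>j. (cmod (e j))\<^sup>2 * real (Suc j) ^ (2 * q))"
      by (rule summable_finite[of "{k}"]) (auto simp: e_def)
  qed
  then have "ell2_inner e \<zeta> = ell2_inner e \<zeta>'"
    using assms unfolding is_adjoint_value_def by metis
  then show "\<zeta> k = \<zeta>' k" by (simp add: inner)
qed

lemma hilbert_adjoint_eq:
  "is_adjoint_value x \<eta> \<zeta> \<Longrightarrow> hilbert_adjoint x \<eta> = \<zeta>"
  unfolding hilbert_adjoint_def using is_adjoint_value_unique by blast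

definition Lstar_carrier :: "((nat \<Rightarrow> complex) \<Rightarrow> (nat \<Rightarrow> complex)) set" where
  "Lstar_carrier = {x. s_operator x \<and> s_space \<subseteq> adjoint_domain x \<and>
     hilbert_adjoint x ` s_space \<subseteq> s_space}"

definition Lstar_star ::
    "((nat \<Rightarrow> complex) \<Rightarrow> (nat \<Rightarrow> complex)) \<Rightarrow> ((nat \<Rightarrow> complex) \<Rightarrow> (nat \<Rightarrow> complex))" where
  "Lstar_star x = restrict (hilbert_adjoint x) s_space"

definition Lstar_seminorm ::
    "nat \<Rightarrow> (nat \<Rightarrow> complex) set \<Rightarrow> ((nat \<Rightarrow> complex) \<Rightarrow> (nat \<Rightarrow> complex)) \<Rightarrow> ennreal" where
  "Lstar_seminorm N B x =
     max (SUP \<xi>\<in>B. ennreal (s_norm N (x \<xi>))) (SUP \<xi>\<in>B. ennreal (s_norm N (Lstar_star x \<xi>)))"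

definition Lstar :: "((nat \<Rightarrow> complex) \<Rightarrow> (nat \<Rightarrow> complex)) top_star_algebra" where
  "Lstar = \<lparr>
     alg_carrier = Lstar_carrier,
     alg_add = (\<lambda>x y. \<lambda>\<xi>\<in>s_space. \<lambda>j. x \<xi> j + y \<xi> j),
     alg_scale = (\<lambda>c x. \<lambda>\<xi>\<in>s_space. \<lambda>j. c * x \<xi> j),
     alg_mult = (\<lambda>x y. \<lambda>\<xi>\<in>s_space. x (y \<xi>)),
     alg_star = Lstar_star,
     alg_topology =
       seminorm_topology Lstar_carrier (\<lambda>x y. \<lambda>\<xi>\<in>s_space. \<lambda>j. x \<xi> j - y \<xi> j)
         {Lstar_seminorm N B | N B. s_bounded B}\<rparr>"

end

theory Submission
  imports Defs "HOL-Real_Asymp.Real_Asymp"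
begin

text \<open>Let \<open>\<phi>\<close> be an isomorphism onto a subalgebra of \<open>L\<^sup>*(s)\<close> and put \<open>u\<^sub>a(z) = exp (i a z)\<close> for
  real \<open>a\<close>. Since \<open>u\<^sub>a\<^sup>* = u\<^sub>-\<^sub>a\<close>, we have \<open>u\<^sub>a\<^sup>* u\<^sub>a = 1\<close>, so \<open>\<bar>\<phi>(u\<^sub>a) \<xi>\<bar>\<^sub>0 = \<bar>\<phi>(1) \<xi>\<bar>\<^sub>0\<close> does not depend on
  \<open>a\<close>, although \<open>u\<^sub>n\<close> has supremum \<open>e\<^sup>n\<close> on the disc. Continuity of \<open>\<phi>\<close> bounds \<open>\<bar>\<phi>(u\<^sub>n) \<xi>\<bar>\<^sub>2\<^sub>N\<close> by a
  polynomial in \<open>n\<close> times \<open>e\<^sup>n\<close>, and interpolating the norm with index \<open>N\<close> between those with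
  indices \<open>0\<close> and \<open>2 N\<close> gives \<open>\<phi>(e\<^sup>-\<^sup>n u\<^sub>n) \<rightarrow> 0\<close>, uniformly on bounded sets. But \<open>e\<^sup>-\<^sup>n u\<^sub>n\<close> has
  supremum norm 1, contradicting continuity of the inverse of \<open>\<phi>\<close>.\<close>

section \<open>Convergence in seminorm topologies\<close>

text \<open>The subbase contains balls about all points of \<open>V\<close>, not only about
  \<open>x0\<close>. The triangle inequality fits a ball about \<open>x0\<close> into each of those
  containing \<open>x0\<close>; finite intersections and unions then preserve eventual
  membership.\<close>

lemma limitin_seminorm_topologyI:
  assumes x0: "x0 \<in> V" "P \<noteq> {}" "\<And>x p. x \<in> V \<Longrightarrow> p \<in> P \<Longrightarrow> p (d x x) = 0"
    and X: "\<And>n. X n \<in> V"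
    and tri: "\<And>p x y z. p \<in> P \<Longrightarrow> x \<in> V \<Longrightarrow> y \<in> V \<Longrightarrow> z \<in> V \<Longrightarrow> p (d x z) \<le> p (d x y) + p (d y z)"
    and lim: "\<And>p e. p \<in> P \<Longrightarrow> e > 0 \<Longrightarrow> \<forall>\<^sub>F n in F. p (d (X n) x0) < ennreal e"
  shows "limitin (seminorm_topology V d P) X x0 F"
  unfolding limitin_def
proof (intro conjI allI impI)
  show "x0 \<in> topspace (seminorm_topology V d P)"
    using x0 topspace_seminorm_topology[of P V d] by blast
next
  fix U assume U: "openin (seminorm_topology V d P) U \<and> x0 \<in> U"
  have "generate_topology_on {{y \<in> V. p (d y x) < ennreal e} | x p e. x \<in> V \<and> p \<in> P \<and> e > 0} U"
    using U by (simp add: seminorm_topology_def openin_topology_generated_by_iff)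
  moreover have "x0 \<in> U" using U by blast
  ultimately show "\<forall>\<^sub>F n in F. X n \<in> U"
  proof (induction rule: generate_topology_on.induct)
    case Empty
    then show ?case by simp
  next
    case (Int a b)
    then show ?case by (simp add: eventually_conj)
  next
    case (UN K)
    then obtain k where k: "k \<in> K" "x0 \<in> k" by blast
    then have "\<forall>\<^sub>F n in F. X n \<in> k" using UN by blast
    then show ?case by (rule eventually_mono) (use k in blast)
  next
    case (Basis S)
    then obtain x p e where S: "S = {y \<in> V. p (d y x) < ennreal e}" "x \<in> V" "p \<in> P" "e > 0"
      by blast
    with Basis have lt: "p (d x0 x) < ennreal e" by simp
    \<comment> \<open>Being below \<open>ennreal e\<close>, the distance from \<open>x0\<close> to
      the centre is a real number \<open>r\<close>, and \<open>e - r\<close> is a positive radius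
      for a ball about \<open>x0\<close> that fits inside.\<close>
    then obtain r where r: "p (d x0 x) = ennreal r" "r \<ge> 0"
      by (metis ennreal_cases ennreal_less_top not_less_iff_gr_or_eq order_less_trans top.not_eq_extremum)
    have re: "r < e" using lt r by (simp add: ennreal_less_iff)
    have "\<forall>\<^sub>F n in F. p (d (X n) x0) < ennreal (e - r)"
      using lim S re by simp
    then show ?case
    proof (rule eventually_mono)
      fix n assume n: "p (d (X n) x0) < ennreal (e - r)"
      have "p (d (X n) x) \<le> p (d (X n) x0) + ennreal r"
        using tri[of p "X n" x0 x] S X x0 r by simp
      also have "\<dots> < ennreal (e - r) + ennreal r"
        using n by (simp add: ennreal_add_left_cancel_less add.commute[of _ "ennreal r"])
      also have "\<dots> = ennreal e" using re r by (simp flip: ennreal_plus)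
      finally show "X n \<in> S" using S X by simp
    qed
  qed
qed

lemma limitin_seminorm_topologyD:
  assumes "limitin (seminorm_topology V d P) X x0 F"
    and "x0 \<in> V" "p \<in> P" "p (d x0 x0) = 0" "e > 0"
  shows "\<forall>\<^sub>F n in F. p (d (X n) x0) < ennreal e"
proof -
  have "openin (seminorm_topology V d P) {y \<in> V. p (d y x0) < ennreal e}"
    unfolding seminorm_topology_def
    by (rule topology_generated_by_Basis) (use assms in blast)
  moreover have "x0 \<in> {y \<in> V. p (d y x0) < ennreal e}" using assms by simp
  ultimately have "\<forall>\<^sub>F n in F. X n \<in> {y \<in> V. p (d y x0) < ennreal e}"
    using assms(1) unfolding limitin_def by blast
  then show ?thesis by (rule eventually_mono) simp
qed

section \<open>The algebra of smooth functions on the disc\<close>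

abbreviation A_infty_minus :: "(complex \<Rightarrow> complex) \<Rightarrow> (complex \<Rightarrow> complex) \<Rightarrow> complex \<Rightarrow> complex" where
  "A_infty_minus \<equiv> \<lambda>f g. \<lambda>z\<in>unit_disc. f z - g z"

lemma A_infty_norm_leI:
  assumes "\<And>z j. z \<in> unit_disc \<Longrightarrow> j \<le> p \<Longrightarrow> ennreal (cmod ((deriv ^^ j) f z)) \<le> C"
  shows "A_infty_norm p f \<le> C"
  unfolding A_infty_norm_def using assms by (auto intro!: Sup_least)

lemma A_infty_norm_upper:
  assumes "z \<in> unit_disc" "j \<le> p"
  shows "ennreal (cmod ((deriv ^^ j) f z)) \<le> A_infty_norm p f"
  unfolding A_infty_norm_def using assms by (auto intro!: Sup_upper)

lemma A_infty_carrier_holomorphic: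
  assumes "f \<in> A_infty_carrier"
  shows "f holomorphic_on unit_disc"
  using assms unfolding A_infty_carrier_def in_disc_algebra_def
  by (metis (mono_tags, lifting) funpow_0 mem_Collect_eq)

text \<open>Higher derivatives at a point of the open disc depend only on nearby values, so the
  value \<open>undefined\<close> outside the disc is harmless.\<close>

lemma higher_deriv_restrict:
  assumes "f holomorphic_on unit_disc" "z \<in> unit_disc"
  shows "(deriv ^^ j) (\<lambda>z\<in>unit_disc. f z) z = (deriv ^^ j) f z"
proof (rule higher_deriv_transform_within_open)
  show "(\<lambda>z\<in>unit_disc. f z) holomorphic_on unit_disc"
    by (rule holomorphic_transform[OF assms(1)]) simp
qed (use assms in auto)

lemma higher_deriv_A_infty_minus:
  assumes "f \<in> A_infty_carrier" "g \<in> A_infty_carrier" "z \<in> unit_disc"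
  shows "(deriv ^^ j) (A_infty_minus f g) z = (deriv ^^ j) f z - (deriv ^^ j) g z"
proof -
  note hol = assms(1,2)[THEN A_infty_carrier_holomorphic]
  show ?thesis
    by (subst higher_deriv_restrict[OF holomorphic_on_diff[OF hol] assms(3)])
       (rule higher_deriv_diff[OF hol open_ball assms(3)])
qed

lemma A_infty_norm_triangle:
  assumes "f \<in> A_infty_carrier" "g \<in> A_infty_carrier" "h \<in> A_infty_carrier"
  shows "A_infty_norm p (A_infty_minus f h) \<le>
    A_infty_norm p (A_infty_minus f g) + A_infty_norm p (A_infty_minus g h)"
proof (rule A_infty_norm_leI)
  fix z j assume z: "z \<in> unit_disc" "j \<le> p"
  have "ennreal (cmod ((deriv ^^ j) (A_infty_minus f h) z)) \<le>
    ennreal (cmod ((deriv ^^ j) (A_infty_minus f g) z) + cmod ((deriv ^^ j) (A_infty_minus g h) z))"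
    using assms z norm_triangle_ineq[of "(deriv ^^ j) f z - (deriv ^^ j) g z" "(deriv ^^ j) g z - (deriv ^^ j) h z"]
    by (intro ennreal_leI) (simp add: higher_deriv_A_infty_minus)
  also have "\<dots> = ennreal (cmod ((deriv ^^ j) (A_infty_minus f g) z)) + ennreal (cmod ((deriv ^^ j) (A_infty_minus g h) z))"
    by simp
  also have "\<dots> \<le> A_infty_norm p (A_infty_minus f g) + A_infty_norm p (A_infty_minus g h)"
    by (intro add_mono A_infty_norm_upper z)
  finally show "ennreal (cmod ((deriv ^^ j) (A_infty_minus f h) z)) \<le>
    A_infty_norm p (A_infty_minus f g) + A_infty_norm p (A_infty_minus g h)" .
qed

lemma A_infty_norm_self:
  assumes "f \<in> A_infty_carrier"
  shows "A_infty_norm p (A_infty_minus f f) = 0"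
proof -
  have "A_infty_norm p (A_infty_minus f f) \<le> 0"
    by (rule A_infty_norm_leI) (simp only: higher_deriv_A_infty_minus[OF assms assms], simp)
  then show ?thesis by simp
qed

text \<open>The multiples of \<open>u_a(z) = exp (i a z)\<close>. With the factor \<open>c\<close>
  the family is closed under scaling, products and the involution; it contains the unit
  (\<open>c = 1\<close>, \<open>a = 0\<close>) and zero (\<open>c = 0\<close>, any
  \<open>a\<close>).\<close>

definition exp_fun :: "complex \<Rightarrow> real \<Rightarrow> complex \<Rightarrow> complex" where
  "exp_fun c a = (\<lambda>z\<in>unit_disc. c * exp (\<i> * of_real a * z))"

lemma higher_deriv_exp:
  "(deriv ^^ j) (\<lambda>z. c * exp (w * z)) = (\<lambda>z. c * w ^ j * exp (w * z :: complex))"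
proof (induction j)
  case (Suc j)
  have "deriv (\<lambda>z. c * w ^ j * exp (w * z)) z = c * w ^ Suc j * exp (w * z)" for z
    by (rule DERIV_imp_deriv) (auto intro!: derivative_eq_intros)
  with Suc show ?case by auto
qed auto

lemma higher_deriv_exp_fun:
  assumes "z \<in> unit_disc"
  shows "(deriv ^^ j) (exp_fun c a) z = c * (\<i> * of_real a) ^ j * exp (\<i> * of_real a * z)"
  unfolding exp_fun_def
  by (subst higher_deriv_restrict[OF _ assms]) (auto intro!: holomorphic_intros simp: higher_deriv_exp)

lemma exp_fun_in_A_infty: "exp_fun c a \<in> A_infty_carrier"
  unfolding A_infty_carrier_def in_disc_algebra_def
proof (intro CollectI conjI allI)
  show "exp_fun c a \<in> extensional unit_disc" by (simp add: exp_fun_def)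
next
  fix k
  let ?g = "\<lambda>z. c * (\<i> * of_real a) ^ k * exp (\<i> * of_real a * z)"
  have "?g holomorphic_on unit_disc" by (intro holomorphic_intros)
  then show "(deriv ^^ k) (exp_fun c a) holomorphic_on unit_disc"
    by (rule holomorphic_transform) (simp add: higher_deriv_exp_fun)
  have "continuous_on (closure unit_disc) ?g" by (intro continuous_intros)
  then show "\<exists>g. continuous_on (closure unit_disc) g \<and> (\<forall>z\<in>unit_disc. g z = (deriv ^^ k) (exp_fun c a) z)"
    by (intro exI[of _ ?g]) (simp add: higher_deriv_exp_fun)
qed

text \<open>Each derivative contributes a factor of modulus \<open>\<bar>a\<bar>\<close>, and the
  exponential has modulus \<open>exp (- a * Im z)\<close>, at most \<open>exp \<bar>a\<bar>\<close>
  on the disc. The base \<open>1 + \<bar>a\<bar>\<close> is at least 1, so its powers increase with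
  the order \<open>j\<close> even when \<open>\<bar>a\<bar> < 1\<close>.\<close>

lemma A_infty_norm_exp_fun_le:
  "A_infty_norm p (exp_fun c a) \<le> ennreal (cmod c * (1 + \<bar>a\<bar>) ^ p * exp \<bar>a\<bar>)"
proof (rule A_infty_norm_leI)
  fix z j assume z: "z \<in> unit_disc" "j \<le> p"
  have "\<bar>a\<bar> ^ j \<le> (1 + \<bar>a\<bar>) ^ j" by (intro power_mono) auto
  also have "\<dots> \<le> (1 + \<bar>a\<bar>) ^ p" using z by (intro power_increasing) auto
  finally have 1: "\<bar>a\<bar> ^ j \<le> (1 + \<bar>a\<bar>) ^ p" .
  have "\<bar>Im z\<bar> \<le> 1" using z abs_Im_le_cmod[of z] by simp
  then have "\<bar>a * Im z\<bar> \<le> \<bar>a\<bar>" by (simp add: abs_mult mult_left_le)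
  then have 2: "exp (- (a * Im z)) \<le> exp \<bar>a\<bar>" by simp
  have "cmod ((deriv ^^ j) (exp_fun c a) z) = cmod c * \<bar>a\<bar> ^ j * exp (- (a * Im z))"
    using z by (simp add: higher_deriv_exp_fun norm_mult norm_power)
  also have "\<dots> \<le> cmod c * (1 + \<bar>a\<bar>) ^ p * exp \<bar>a\<bar>"
    using 1 2 by (intro mult_mono) auto
  finally show "ennreal (cmod ((deriv ^^ j) (exp_fun c a) z)) \<le> ennreal (cmod c * (1 + \<bar>a\<bar>) ^ p * exp \<bar>a\<bar>)"
    by (rule ennreal_leI)
qed

lemma A_infty_norm_exp_fun_ge:
  "ennreal (exp (-1)) \<le> A_infty_norm 0 (exp_fun (of_real (exp (- real n))) (real n))"
proof -
  \<comment> \<open>On the closed disc the modulus is maximal at \<open>-i\<close>, which the open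
    disc excludes. At \<open>-i r\<close> it is \<open>exp (n r - n)\<close>, and this
    \<open>r\<close> makes the exponent \<open>- n / (n + 1)\<close>, at least
    \<open>-1\<close>.\<close>
  define r where "r = real n / (real n + 1)"
  define z where "z = - \<i> * of_real r"
  have "\<bar>r\<bar> < 1" by (simp add: r_def)
  then have z: "z \<in> unit_disc" by (simp add: z_def norm_mult)
  have "- 1 \<le> real n * r - real n" by (simp add: r_def field_simps)
  then have "exp (-1) \<le> exp (real n * r - real n)" by simp
  also have "\<dots> = cmod ((deriv ^^ 0) (exp_fun (of_real (exp (- real n))) (real n)) z)"
    unfolding higher_deriv_exp_fun[OF z]
    by (simp add: norm_mult z_def flip: exp_add)
  finally have "ennreal (exp (-1)) \<le> ennreal \<dots>" by (rule ennreal_leI)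
  also have "\<dots> \<le> A_infty_norm 0 (exp_fun (of_real (exp (- real n))) (real n))"
    by (rule A_infty_norm_upper[OF z]) simp
  finally show ?thesis .
qed

lemma A_infty_minus_exp_fun_zero: "A_infty_minus (exp_fun c a) (exp_fun 0 b) = exp_fun c a"
  by (auto simp: exp_fun_def)

text \<open>The hypothesis makes the upper bound for every \<open>A_infty_norm p\<close> tend to 0,
  so later only growth rates of \<open>c\<close> and \<open>a\<close> need checking.\<close>

lemma limitin_exp_fun:
  assumes "\<And>p. (\<lambda>n. cmod (c n) * (1 + \<bar>a n\<bar>) ^ p * exp \<bar>a n\<bar>) \<longlonglongrightarrow> 0"
  shows "limitin (alg_topology A_infty) (\<lambda>n. exp_fun (c n) (a n)) (exp_fun 0 0) sequentially"
  unfolding A_infty_def top_star_algebra.simps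
proof (rule limitin_seminorm_topologyI)
  fix q :: "(complex \<Rightarrow> complex) \<Rightarrow> ennreal" and e :: real assume "q \<in> range A_infty_norm" "e > 0"
  then obtain p where q: "q = A_infty_norm p" by blast
  have "\<forall>\<^sub>F n in sequentially. cmod (c n) * (1 + \<bar>a n\<bar>) ^ p * exp \<bar>a n\<bar> < e"
    using order_tendstoD(2)[OF assms \<open>e > 0\<close>] .
  then show "\<forall>\<^sub>F n in sequentially. q (A_infty_minus (exp_fun (c n) (a n)) (exp_fun 0 0)) < ennreal e"
  proof (rule eventually_mono)
    fix n assume "cmod (c n) * (1 + \<bar>a n\<bar>) ^ p * exp \<bar>a n\<bar> < e"
    then show "q (A_infty_minus (exp_fun (c n) (a n)) (exp_fun 0 0)) < ennreal e"
      unfolding q A_infty_minus_exp_fun_zero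
      by (intro le_less_trans[OF A_infty_norm_exp_fun_le] ennreal_lessI \<open>e > 0\<close>)
  qed
qed (use exp_fun_in_A_infty A_infty_norm_self A_infty_norm_triangle in blast)+

lemma not_limitin_exp_fun:
  "\<not> limitin (alg_topology A_infty) (\<lambda>n. exp_fun (of_real (exp (- real n))) (real n)) (exp_fun 0 0) sequentially"
proof
  assume "limitin (alg_topology A_infty) (\<lambda>n. exp_fun (of_real (exp (- real n))) (real n)) (exp_fun 0 0) sequentially"
  then have "\<forall>\<^sub>F n in sequentially. A_infty_norm 0 (A_infty_minus
    (exp_fun (of_real (exp (- real n))) (real n)) (exp_fun 0 0)) < ennreal (exp (-1))"
    unfolding A_infty_def top_star_algebra.simps
    by (rule limitin_seminorm_topologyD)
       (use exp_fun_in_A_infty A_infty_norm_self exp_gt_zero in blast)+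
  then have "\<forall>\<^sub>F n in sequentially. False"
    unfolding A_infty_minus_exp_fun_zero
    by (rule eventually_mono) (use A_infty_norm_exp_fun_ge leD in blast)
  then show False by simp
qed

section \<open>The algebra of operators on the space of rapidly decreasing sequences\<close>

lemma s_space_imp_ell2: "\<xi> \<in> s_space \<Longrightarrow> \<xi> \<in> ell2"
  unfolding s_space_def ell2_def by (drule CollectD, drule spec[of _ 0]) simp

lemma ell2_summable_inner:
  assumes "\<xi> \<in> ell2" "\<eta> \<in> ell2"
  shows "summable (\<lambda>j. \<xi> j * cnj (\<eta> j))"
proof (rule summable_comparison_test')
  show "summable (\<lambda>j. (cmod (\<xi> j))\<^sup>2 + (cmod (\<eta> j))\<^sup>2)"
    using assms by (auto simp: ell2_def intro: summable_add)
  fix n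
  have "0 \<le> (cmod (\<xi> n) - cmod (\<eta> n))\<^sup>2" "0 \<le> cmod (\<xi> n) * cmod (\<eta> n)" by simp_all
  then show "norm (\<xi> n * cnj (\<eta> n)) \<le> (cmod (\<xi> n))\<^sup>2 + (cmod (\<eta> n))\<^sup>2"
    unfolding power2_diff norm_mult complex_mod_cnj by linarith
qed

lemma ell2_inner_diff_left:
  assumes "\<xi> \<in> ell2" "\<eta> \<in> ell2" "\<zeta> \<in> ell2"
  shows "ell2_inner (\<lambda>j. \<xi> j - \<eta> j) \<zeta> = ell2_inner \<xi> \<zeta> - ell2_inner \<eta> \<zeta>"
  unfolding ell2_inner_def
  using suminf_diff[OF ell2_summable_inner[OF assms(1,3)] ell2_summable_inner[OF assms(2,3)]]
  by (simp add: left_diff_distrib)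

lemma ell2_inner_diff_right:
  assumes "\<xi> \<in> ell2" "\<eta> \<in> ell2" "\<zeta> \<in> ell2"
  shows "ell2_inner \<xi> (\<lambda>j. \<eta> j - \<zeta> j) = ell2_inner \<xi> \<eta> - ell2_inner \<xi> \<zeta>"
  unfolding ell2_inner_def
  using suminf_diff[OF ell2_summable_inner[OF assms(1,2)] ell2_summable_inner[OF assms(1,3)]]
  by (simp add: right_diff_distrib)

lemma s_norm_nonneg: "\<xi> \<in> s_space \<Longrightarrow> 0 \<le> s_norm q \<xi>"
  unfolding s_norm_def s_space_def by (auto intro!: suminf_nonneg)

lemma s_norm_power2:
  assumes "\<xi> \<in> s_space"
  shows "(s_norm q \<xi>)\<^sup>2 = (\<Sum>j. (cmod (\<xi> j))\<^sup>2 * real (Suc j) ^ (2 * q))"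
  unfolding s_norm_def using assms
  by (subst real_sqrt_pow2) (auto simp: s_space_def intro!: suminf_nonneg)

lemma ell2_inner_self:
  assumes "\<xi> \<in> s_space"
  shows "ell2_inner \<xi> \<xi> = of_real ((s_norm 0 \<xi>)\<^sup>2)"
proof -
  have "summable (\<lambda>j. (cmod (\<xi> j))\<^sup>2)" using s_space_imp_ell2[OF assms] by (simp add: ell2_def)
  then show ?thesis
    by (simp add: s_norm_power2[OF assms] ell2_inner_def suminf_of_real complex_norm_square[symmetric])
qed

lemma s_norm_scale:
  assumes "\<xi> \<in> s_space"
  shows "s_norm q (\<lambda>j. c * \<xi> j) = cmod c * s_norm q \<xi>"
proof -
  have s: "summable (\<lambda>j. (cmod (\<xi> j))\<^sup>2 * real (Suc j) ^ (2 * q))"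
    using assms by (simp add: s_space_def)
  have "(\<Sum>j. (cmod (c * \<xi> j))\<^sup>2 * real (Suc j) ^ (2 * q)) =
    (cmod c)\<^sup>2 * (\<Sum>j. (cmod (\<xi> j))\<^sup>2 * real (Suc j) ^ (2 * q))"
    by (subst suminf_mult[OF s, symmetric]) (simp add: norm_mult power_mult_distrib mult.assoc)
  then show ?thesis by (simp add: s_norm_def real_sqrt_mult)
qed

text \<open>Writes the weighted norm as a limit of finite Euclidean norms, so that Minkowski's
  inequality for \<open>L2_set\<close> passes to infinite sums.\<close>

lemma s_norm_L2_set:
  assumes "\<xi> \<in> s_space"
  shows "(\<lambda>n. L2_set (\<lambda>j. cmod (\<xi> j) * real (Suc j) ^ q) {..<n}) \<longlonglongrightarrow> s_norm q \<xi>"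
proof -
  have "summable (\<lambda>j. (cmod (\<xi> j))\<^sup>2 * real (Suc j) ^ (2 * q))"
    using assms by (simp add: s_space_def)
  then have "(\<lambda>n. sqrt (\<Sum>j<n. (cmod (\<xi> j))\<^sup>2 * real (Suc j) ^ (2 * q))) \<longlonglongrightarrow> s_norm q \<xi>"
    unfolding s_norm_def by (intro tendsto_real_sqrt summable_LIMSEQ)
  then show ?thesis by (simp add: L2_set_def power_mult_distrib power_mult mult.commute[of 2])
qed

lemma s_space_diff:
  assumes "\<xi> \<in> s_space" "\<eta> \<in> s_space"
  shows "(\<lambda>j. \<xi> j - \<eta> j) \<in> s_space"
  unfolding s_space_def
proof (intro CollectI allI)
  fix q
  have "summable (\<lambda>j. 2 * ((cmod (\<xi> j))\<^sup>2 * real (Suc j) ^ (2 * q)) + 2 * ((cmod (\<eta> j))\<^sup>2 * real (Suc j) ^ (2 * q)))"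
    using assms by (intro summable_add summable_mult) (auto simp: s_space_def)
  then show "summable (\<lambda>j. (cmod (\<xi> j - \<eta> j))\<^sup>2 * real (Suc j) ^ (2 * q))"
  proof (rule summable_comparison_test')
    fix n
    have "(cmod (\<xi> n - \<eta> n))\<^sup>2 \<le> (cmod (\<xi> n) + cmod (\<eta> n))\<^sup>2"
      by (intro power_mono norm_triangle_ineq4) auto
    also have "\<dots> \<le> 2 * (cmod (\<xi> n))\<^sup>2 + 2 * (cmod (\<eta> n))\<^sup>2"
      using zero_le_power2[of "cmod (\<xi> n) - cmod (\<eta> n)"] by (simp add: power2_diff power2_sum)
    finally have "(cmod (\<xi> n - \<eta> n))\<^sup>2 * real (Suc n) ^ (2 * q) \<le>
      (2 * (cmod (\<xi> n))\<^sup>2 + 2 * (cmod (\<eta> n))\<^sup>2) * real (Suc n) ^ (2 * q)"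
      by (intro mult_right_mono) auto
    then show "norm ((cmod (\<xi> n - \<eta> n))\<^sup>2 * real (Suc n) ^ (2 * q)) \<le>
      2 * ((cmod (\<xi> n))\<^sup>2 * real (Suc n) ^ (2 * q)) + 2 * ((cmod (\<eta> n))\<^sup>2 * real (Suc n) ^ (2 * q))"
      by (simp add: distrib_right mult.assoc del: of_nat_Suc)
  qed
qed

lemma s_norm_triangle:
  assumes "\<xi> \<in> s_space" "\<eta> \<in> s_space" "\<zeta> \<in> s_space"
  shows "s_norm q (\<lambda>j. \<xi> j - \<zeta> j) \<le> s_norm q (\<lambda>j. \<xi> j - \<eta> j) + s_norm q (\<lambda>j. \<eta> j - \<zeta> j)"
proof (rule LIMSEQ_le)
  show "(\<lambda>n. L2_set (\<lambda>j. cmod (\<xi> j - \<zeta> j) * real (Suc j) ^ q) {..<n}) \<longlonglongrightarrow> s_norm q (\<lambda>j. \<xi> j - \<zeta> j)"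
    using assms by (intro s_norm_L2_set s_space_diff)
  show "(\<lambda>n. L2_set (\<lambda>j. cmod (\<xi> j - \<eta> j) * real (Suc j) ^ q) {..<n} +
     L2_set (\<lambda>j. cmod (\<eta> j - \<zeta> j) * real (Suc j) ^ q) {..<n})
    \<longlonglongrightarrow> s_norm q (\<lambda>j. \<xi> j - \<eta> j) + s_norm q (\<lambda>j. \<eta> j - \<zeta> j)"
    using assms by (intro tendsto_add s_norm_L2_set s_space_diff)
  have "L2_set (\<lambda>j. cmod (\<xi> j - \<zeta> j) * real (Suc j) ^ q) {..<n} \<le>
     L2_set (\<lambda>j. cmod (\<xi> j - \<eta> j) * real (Suc j) ^ q) {..<n} +
     L2_set (\<lambda>j. cmod (\<eta> j - \<zeta> j) * real (Suc j) ^ q) {..<n}" for n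
  proof (rule order_trans[OF L2_set_mono L2_set_triangle_ineq])
    fix j
    show "cmod (\<xi> j - \<zeta> j) * real (Suc j) ^ q \<le>
      cmod (\<xi> j - \<eta> j) * real (Suc j) ^ q + cmod (\<eta> j - \<zeta> j) * real (Suc j) ^ q"
      using norm_triangle_ineq[of "\<xi> j - \<eta> j" "\<eta> j - \<zeta> j"]
      by (simp add: mult_right_mono flip: distrib_right)
  qed auto
  then show "\<exists>N. \<forall>n\<ge>N. L2_set (\<lambda>j. cmod (\<xi> j - \<zeta> j) * real (Suc j) ^ q) {..<n} \<le>
     L2_set (\<lambda>j. cmod (\<xi> j - \<eta> j) * real (Suc j) ^ q) {..<n} +
     L2_set (\<lambda>j. cmod (\<eta> j - \<zeta> j) * real (Suc j) ^ q) {..<n}" by blast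
qed

text \<open>An additive form of the log-convexity
  \<open>|\<xi>|_N^2 \<le> |\<xi>|_0 |\<xi>|_(2N)\<close>, which is its infimum over
  \<open>t\<close>. With \<open>t\<close> free the estimate holds term by term; \<open>t\<close> is
  chosen in the application.\<close>

lemma s_norm_interpolation:
  assumes "\<xi> \<in> s_space" "t > 0"
  shows "(s_norm N \<xi>)\<^sup>2 \<le> (t * (s_norm 0 \<xi>)\<^sup>2 + (s_norm (2 * N) \<xi>)\<^sup>2 / t) / 2"
proof -
  have sm: "summable (\<lambda>j. (cmod (\<xi> j))\<^sup>2 * real (Suc j) ^ (2 * q))" for q
    using assms by (simp add: s_space_def)
  let ?f = "\<lambda>q j. (cmod (\<xi> j))\<^sup>2 * real (Suc j) ^ (2 * q)"
  have "(s_norm N \<xi>)\<^sup>2 = (\<Sum>j. ?f N j)" by (rule s_norm_power2[OF assms(1)])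
  also have "\<dots> \<le> (\<Sum>j. (t * ?f 0 j + ?f (2 * N) j / t) / 2)"
  proof (rule suminf_le)
    fix j
    \<comment> \<open>AM-GM for \<open>t\<close> and \<open>w\<^sup>2 / t\<close>\<close>
    define w where "w = real (Suc j) ^ (2 * N)"
    have "0 \<le> (t - w)\<^sup>2" by simp
    then have "w \<le> (t + w\<^sup>2 / t) / 2"
      using assms(2) by (simp add: power2_diff field_simps power2_eq_square)
    then have "(cmod (\<xi> j))\<^sup>2 * w \<le> (cmod (\<xi> j))\<^sup>2 * ((t + w\<^sup>2 / t) / 2)"
      by (intro mult_left_mono) auto
    moreover have "real (Suc j) ^ (2 * (2 * N)) = w\<^sup>2"
      unfolding w_def by (metis mult.commute power_mult)
    ultimately show "?f N j \<le> (t * ?f 0 j + ?f (2 * N) j / t) / 2"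
      by (simp add: w_def algebra_simps del: of_nat_Suc)
  qed (intro summable_divide summable_add summable_mult sm)+
  also have "\<dots> = (t * (\<Sum>j. ?f 0 j) + (\<Sum>j. ?f (2 * N) j) / t) / 2"
    by (intro sums_unique[symmetric] sums_divide sums_add sums_mult summable_sums sm)
  also have "\<dots> = (t * (s_norm 0 \<xi>)\<^sup>2 + (s_norm (2 * N) \<xi>)\<^sup>2 / t) / 2"
    by (simp only: s_norm_power2[OF assms(1)])
  finally show ?thesis .
qed

section \<open>Operators, adjoints and the seminorms of \<open>Lstar\<close>\<close>

abbreviation Lstar_minus where
  "Lstar_minus \<equiv> \<lambda>x y. \<lambda>\<xi>\<in>s_space. \<lambda>j. x \<xi> j - y \<xi> (j :: nat) :: complex"

lemma Lstar_carrier_maps: "x \<in> Lstar_carrier \<Longrightarrow> \<xi> \<in> s_space \<Longrightarrow> x \<xi> \<in> s_space"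
  unfolding Lstar_carrier_def s_operator_def by auto

lemma Lstar_star_maps: "x \<in> Lstar_carrier \<Longrightarrow> \<xi> \<in> s_space \<Longrightarrow> Lstar_star x \<xi> \<in> s_space"
  unfolding Lstar_carrier_def Lstar_star_def by auto

lemma is_adjoint_value_Lstar_star:
  assumes "x \<in> Lstar_carrier" "\<eta> \<in> s_space"
  shows "is_adjoint_value x \<eta> (Lstar_star x \<eta>)"
proof -
  obtain \<zeta> where "is_adjoint_value x \<eta> \<zeta>"
    using assms unfolding Lstar_carrier_def adjoint_domain_def by blast
  with hilbert_adjoint_eq[OF this] show ?thesis using assms by (simp add: Lstar_star_def)
qed

text \<open>The difference of the two adjoints satisfies the defining identity of the adjoint, and
  adjoint values are unique. This serves the half of \<open>Lstar_seminorm\<close> that involves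
  \<open>Lstar_star\<close>.\<close>

lemma Lstar_star_minus:
  assumes "x \<in> Lstar_carrier" "y \<in> Lstar_carrier" "\<eta> \<in> s_space"
  shows "Lstar_star (Lstar_minus x y) \<eta> = (\<lambda>j. Lstar_star x \<eta> j - Lstar_star y \<eta> j)"
proof -
  have "is_adjoint_value (Lstar_minus x y) \<eta> (\<lambda>j. Lstar_star x \<eta> j - Lstar_star y \<eta> j)"
    unfolding is_adjoint_value_def
  proof (intro conjI ballI)
    show "(\<lambda>j. Lstar_star x \<eta> j - Lstar_star y \<eta> j) \<in> ell2"
      using assms by (intro s_space_imp_ell2 s_space_diff Lstar_star_maps)
    fix \<xi> assume "\<xi> \<in> s_space"
    then show "ell2_inner (Lstar_minus x y \<xi>) \<eta> = ell2_inner \<xi> (\<lambda>j. Lstar_star x \<eta> j - Lstar_star y \<eta> j)"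
      using assms is_adjoint_value_Lstar_star[of x \<eta>] is_adjoint_value_Lstar_star[of y \<eta>]
      by (simp add: ell2_inner_diff_left ell2_inner_diff_right s_space_imp_ell2 Lstar_star_maps
          Lstar_carrier_maps is_adjoint_value_def)
  qed
  with hilbert_adjoint_eq[OF this] show ?thesis using assms by (simp add: Lstar_star_def)
qed

lemma Lstar_seminorm_leI:
  assumes "\<And>\<xi>. \<xi> \<in> B \<Longrightarrow> ennreal (s_norm N (x \<xi>)) \<le> C"
    and "\<And>\<xi>. \<xi> \<in> B \<Longrightarrow> ennreal (s_norm N (Lstar_star x \<xi>)) \<le> C"
  shows "Lstar_seminorm N B x \<le> C"
  unfolding Lstar_seminorm_def using assms by (auto intro!: SUP_least)

lemma Lstar_seminorm_upper:
  assumes "\<xi> \<in> B"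
  shows "ennreal (s_norm N (x \<xi>)) \<le> Lstar_seminorm N B x"
    and "ennreal (s_norm N (Lstar_star x \<xi>)) \<le> Lstar_seminorm N B x"
  unfolding Lstar_seminorm_def using assms by (auto intro: SUP_upper le_max_iff_disj[THEN iffD2])

lemma Lstar_seminorm_triangle:
  assumes "x \<in> Lstar_carrier" "y \<in> Lstar_carrier" "z \<in> Lstar_carrier" "B \<subseteq> s_space"
  shows "Lstar_seminorm N B (Lstar_minus x z) \<le>
    Lstar_seminorm N B (Lstar_minus x y) + Lstar_seminorm N B (Lstar_minus y z)"
proof (rule Lstar_seminorm_leI)
  fix \<xi> assume "\<xi> \<in> B"
  then have \<xi>: "\<xi> \<in> s_space" using assms by blast
  have "ennreal (s_norm N (Lstar_minus x z \<xi>)) \<le>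
    ennreal (s_norm N (Lstar_minus x y \<xi>)) + ennreal (s_norm N (Lstar_minus y z \<xi>))"
    using assms \<xi> by (simp add: s_norm_triangle s_norm_nonneg s_space_diff Lstar_carrier_maps flip: ennreal_plus)
  also have "\<dots> \<le> Lstar_seminorm N B (Lstar_minus x y) + Lstar_seminorm N B (Lstar_minus y z)"
    by (intro add_mono Lstar_seminorm_upper \<open>\<xi> \<in> B\<close>)
  finally show "ennreal (s_norm N (Lstar_minus x z \<xi>)) \<le>
    Lstar_seminorm N B (Lstar_minus x y) + Lstar_seminorm N B (Lstar_minus y z)" .
  have "ennreal (s_norm N (Lstar_star (Lstar_minus x z) \<xi>)) \<le>
    ennreal (s_norm N (Lstar_star (Lstar_minus x y) \<xi>)) + ennreal (s_norm N (Lstar_star (Lstar_minus y z) \<xi>))"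
    using assms \<xi>
    by (simp add: Lstar_star_minus s_norm_triangle s_norm_nonneg s_space_diff Lstar_star_maps flip: ennreal_plus)
  also have "\<dots> \<le> Lstar_seminorm N B (Lstar_minus x y) + Lstar_seminorm N B (Lstar_minus y z)"
    by (intro add_mono Lstar_seminorm_upper \<open>\<xi> \<in> B\<close>)
  finally show "ennreal (s_norm N (Lstar_star (Lstar_minus x z) \<xi>)) \<le>
    Lstar_seminorm N B (Lstar_minus x y) + Lstar_seminorm N B (Lstar_minus y z)" .
qed

lemma Lstar_seminorm_self:
  assumes "x \<in> Lstar_carrier" "B \<subseteq> s_space"
  shows "Lstar_seminorm N B (Lstar_minus x x) = 0"
proof -
  have 0: "s_norm N (\<lambda>j. 0) = 0" by (simp add: s_norm_def)
  have "Lstar_seminorm N B (Lstar_minus x x) \<le> 0"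
  proof (rule Lstar_seminorm_leI)
    fix \<xi> assume "\<xi> \<in> B"
    then have \<xi>: "\<xi> \<in> s_space" using assms by blast
    show "ennreal (s_norm N (Lstar_minus x x \<xi>)) \<le> 0"
      using \<xi> by (simp add: 0)
    show "ennreal (s_norm N (Lstar_star (Lstar_minus x x) \<xi>)) \<le> 0"
      unfolding Lstar_star_minus[OF assms(1,1) \<xi>] by (simp add: 0)
  qed
  then show ?thesis by simp
qed

lemma Lstar_minus_zero:
  assumes "x \<in> Lstar_carrier"
  shows "Lstar_minus x (\<lambda>\<xi>\<in>s_space. \<lambda>j. 0) = x"
  using assms by (auto simp: Lstar_carrier_def s_operator_def PiE_def extensional_def restrict_def)

text \<open>Subtracting the zero operator changes nothing, so convergence to it can be read off the
  seminorms of \<open>X n\<close> itself.\<close>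

lemma limitin_Lstar_zero_iff:
  assumes X: "\<And>n. X n \<in> Lstar_carrier" and Z: "(\<lambda>\<xi>\<in>s_space. \<lambda>j. 0) \<in> Lstar_carrier"
  shows "limitin (alg_topology Lstar) X (\<lambda>\<xi>\<in>s_space. \<lambda>j. 0) F \<longleftrightarrow>
    (\<forall>N B e. s_bounded B \<longrightarrow> e > 0 \<longrightarrow> (\<forall>\<^sub>F n in F. Lstar_seminorm N B (X n) < ennreal e))"
    (is "?L \<longleftrightarrow> ?R")
proof
  assume ?L
  show ?R
  proof (intro allI impI)
    fix N B and e :: real assume B: "s_bounded B" "e > 0"
    then have "B \<subseteq> s_space" by (simp add: s_bounded_def)
    have "\<forall>\<^sub>F n in F. Lstar_seminorm N B (Lstar_minus (X n) (\<lambda>\<xi>\<in>s_space. \<lambda>j. 0)) < ennreal e"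
      using \<open>?L\<close> unfolding Lstar_def top_star_algebra.simps
      by (rule limitin_seminorm_topologyD)
         (use B Z in \<open>blast intro: Lstar_seminorm_self[OF Z \<open>B \<subseteq> s_space\<close>]\<close>)+
    then show "\<forall>\<^sub>F n in F. Lstar_seminorm N B (X n) < ennreal e"
      by (simp only: Lstar_minus_zero[OF X])
  qed
next
  assume R: ?R
  \<comment> \<open>The empty set supplies a seminorm, so the family of seminorms is nonempty and
    the topology has the whole carrier as its space.\<close>
  have ne: "s_bounded {}" by (simp add: s_bounded_def)
  show ?L
    unfolding Lstar_def top_star_algebra.simps
  proof (rule limitin_seminorm_topologyI)
    fix p and e :: real assume "p \<in> {Lstar_seminorm N B |N B. s_bounded B}" "e > 0"
    then show "\<forall>\<^sub>F n in F. p (Lstar_minus (X n) (\<lambda>\<xi>\<in>s_space. \<lambda>j. 0)) < ennreal e"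
      unfolding Lstar_minus_zero[OF X] using R by blast
  next
    fix p x assume "x \<in> Lstar_carrier" "p \<in> {Lstar_seminorm N B |N B. s_bounded B}"
    then show "p (Lstar_minus x x) = 0"
      using Lstar_seminorm_self unfolding s_bounded_def by blast
  next
    fix p x y z
    assume "p \<in> {Lstar_seminorm N B |N B. s_bounded B}"
      "x \<in> Lstar_carrier" "y \<in> Lstar_carrier" "z \<in> Lstar_carrier"
    then show "p (Lstar_minus x z) \<le> p (Lstar_minus x y) + p (Lstar_minus y z)"
      using Lstar_seminorm_triangle unfolding s_bounded_def by blast
  qed (use X Z ne in blast)+
qed

text \<open>Moving one factor across the inner product turns \<open><x \<xi>, x \<xi>>\<close> into
  the product of \<open>\<xi>\<close> with \<open>Lstar_star x (x \<xi>)\<close>, so this vector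
  determines the norm of \<open>x \<xi>\<close> with index 0.\<close>

lemma s_norm_eq_of_star_mult_eq:
  assumes "x \<in> Lstar_carrier" "y \<in> Lstar_carrier" "\<xi> \<in> s_space"
    and "Lstar_star x (x \<xi>) = Lstar_star y (y \<xi>)"
  shows "s_norm 0 (x \<xi>) = s_norm 0 (y \<xi>)"
proof -
  have *: "of_real ((s_norm 0 (w \<xi>))\<^sup>2) = ell2_inner \<xi> (Lstar_star w (w \<xi>))" if "w \<in> Lstar_carrier" for w
    using is_adjoint_value_Lstar_star[OF that Lstar_carrier_maps[OF that assms(3)]] assms(3)
      ell2_inner_self[OF Lstar_carrier_maps[OF that assms(3)]]
    by (simp add: is_adjoint_value_def)
  have "(s_norm 0 (x \<xi>))\<^sup>2 = (s_norm 0 (y \<xi>))\<^sup>2"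
    using *[OF assms(1)] *[OF assms(2)] assms(4) by (metis of_real_eq_iff)
  then show ?thesis
    using assms s_norm_nonneg Lstar_carrier_maps by (simp add: power2_eq_iff_nonneg)
qed

section \<open>Exponentials under an isomorphism\<close>

lemma alg_scale_exp_fun: "alg_scale A_infty k (exp_fun c a) = exp_fun (k * c) a"
  by (auto simp: A_infty_def exp_fun_def)

lemma alg_mult_exp_fun: "alg_mult A_infty (exp_fun c a) (exp_fun d b) = exp_fun (c * d) (a + b)"
  by (auto simp: A_infty_def exp_fun_def exp_add algebra_simps)

text \<open>For real \<open>a\<close>, \<open>cnj (exp (i a (cnj z))) = exp (- i a z)\<close>.
  Reversing the frequency makes \<open>u_a\<close> unitary for this involution although it is large
  on the disc.\<close>

lemma alg_star_exp_fun: "alg_star A_infty (exp_fun c a) = exp_fun (cnj c) (- a)"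
  by (auto simp: A_infty_def exp_fun_def exp_cnj)

theorem proposition4p3:
  "\<not> (\<exists>B. closed_star_subalgebra B Lstar \<and>
          isomorphic_top_star_algebras A_infty (sub_top_star_algebra Lstar B))"
proof
  assume "\<exists>B. closed_star_subalgebra B Lstar \<and>
          isomorphic_top_star_algebras A_infty (sub_top_star_algebra Lstar B)"
  then obtain B \<phi> where B: "B \<subseteq> Lstar_carrier"
    and iso: "top_star_algebra_iso A_infty (sub_top_star_algebra Lstar B) \<phi>"
    unfolding closed_star_subalgebra_def star_subalgebra_def isomorphic_top_star_algebras_def
    by (auto simp: Lstar_def)

  \<comment> \<open>The exponentials as operators on \<open>s\<close>\<close>
  define X where "X c a = \<phi> (exp_fun c a)" for c a
  have carrA: "exp_fun c a \<in> alg_carrier A_infty" for c a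
    using exp_fun_in_A_infty by (simp add: A_infty_def)
  have XB: "X c a \<in> B" for c a
    using iso carrA unfolding top_star_algebra_iso_def X_def bij_betw_def
    by (auto simp: sub_top_star_algebra_def)
  then have XL: "X c a \<in> Lstar_carrier" for c a using B by blast
  have "\<phi> (alg_scale A_infty k (exp_fun c a)) = alg_scale (sub_top_star_algebra Lstar B) k (X c a)" for k c a
    using iso carrA unfolding top_star_algebra_iso_def X_def by blast
  then have scale: "X (k * c) a = (\<lambda>\<xi>\<in>s_space. \<lambda>j. k * X c a \<xi> j)" for k c a
    by (simp add: alg_scale_exp_fun X_def sub_top_star_algebra_def Lstar_def)
  have "\<phi> (alg_mult A_infty (exp_fun c a) (exp_fun d b)) =
      alg_mult (sub_top_star_algebra Lstar B) (X c a) (X d b)" for c a d b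
    using iso carrA unfolding top_star_algebra_iso_def X_def by blast
  then have mult: "X (c * d) (a + b) = (\<lambda>\<xi>\<in>s_space. X c a (X d b \<xi>))" for c a d b
    by (simp add: alg_mult_exp_fun X_def sub_top_star_algebra_def Lstar_def)
  have "\<phi> (alg_star A_infty (exp_fun c a)) = alg_star (sub_top_star_algebra Lstar B) (X c a)" for c a
    using iso carrA unfolding top_star_algebra_iso_def X_def by blast
  then have star: "Lstar_star (X c a) = X (cnj c) (- a)" for c a
    by (simp add: alg_star_exp_fun X_def sub_top_star_algebra_def Lstar_def)
  \<comment> \<open>Scaling by 0 identifies the image of the zero function; as \<open>X 0 0\<close>
    lies in the carrier, so does the zero operator.\<close>
  have zero: "X 0 0 = (\<lambda>\<xi>\<in>s_space. \<lambda>j. 0)"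
    using scale[of 0 0 0] by simp
  have Z: "(\<lambda>\<xi>\<in>s_space. \<lambda>j. 0) \<in> Lstar_carrier" using XL[of 0 0] by (simp add: zero)

  \<comment> \<open>Sequential continuity of the isomorphism\<close>
  obtain \<psi> where hom: "homeomorphic_maps (alg_topology A_infty) (subtopology (alg_topology Lstar) B) \<phi> \<psi>"
    using iso unfolding top_star_algebra_iso_def homeomorphic_map_maps
    by (auto simp: sub_top_star_algebra_def)
  have topA: "topspace (alg_topology A_infty) = A_infty_carrier"
    unfolding A_infty_def top_star_algebra.simps
    by (rule topspace_seminorm_topology) (use A_infty_norm_self in blast)+
  have \<psi>X: "\<psi> (X c a) = exp_fun c a" for c a
    using hom exp_fun_in_A_infty unfolding homeomorphic_maps_def X_def by (simp add: topA)

  \<comment> \<open>Continuity of \<open>\<phi>\<close> enters through null sequences instead of a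
    constant comparing seminorms: a sequence tending to 0 in all norms eventually has images of
    seminorm below 1. Both the constant \<open>K\<close> and the smallness for the index
    \<open>2 * N\<close> come from this.\<close>
  have cont: "\<forall>\<^sub>F n in sequentially. Lstar_seminorm N S (X (c n) (a n)) < 1"
    if "\<And>p. (\<lambda>n. cmod (c n) * (1 + \<bar>a n\<bar>) ^ p * exp \<bar>a n\<bar>) \<longlonglongrightarrow> 0" "s_bounded S" for c a N S
  proof -
    have "limitin (subtopology (alg_topology Lstar) B) (\<phi> \<circ> (\<lambda>n. exp_fun (c n) (a n))) (\<phi> (exp_fun 0 0)) sequentially"
      using hom limitin_exp_fun[OF that(1)]
      unfolding homeomorphic_maps_def by (blast intro: continuous_map_limit)
    then have "limitin (alg_topology Lstar) (\<lambda>n. X (c n) (a n)) (\<lambda>\<xi>\<in>s_space. \<lambda>j. 0) sequentially"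
      by (simp add: limitin_subtopology o_def flip: zero X_def)
    then show ?thesis
      using that(2) unfolding limitin_Lstar_zero_iff[OF XL Z] by (metis ennreal_1 zero_less_one)
  qed

  \<comment> \<open>Decay of the normalised exponentials in the operator topology\<close>
  have "limitin (alg_topology Lstar) (\<lambda>n. X (of_real (exp (- real n))) (real n)) (\<lambda>\<xi>\<in>s_space. \<lambda>j. 0) sequentially"
    unfolding limitin_Lstar_zero_iff[OF XL Z]
  proof (intro allI impI)
    fix N S and e :: real
    assume S: "s_bounded S" and e: "e > 0"
    then have Ss: "S \<subseteq> s_space" by (simp add: s_bounded_def)

    \<comment> \<open>The image \<open>X 1 0\<close> of the unit need not be the identity on
      \<open>s\<close>, so its bound on \<open>S\<close> needs an argument. The multiples
      \<open>1 / (n + 1)\<close> of the unit tend to 0; once one has an image of seminorm below 1,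
      its reciprocal is a bound.\<close>
    have "\<forall>\<^sub>F n in sequentially. Lstar_seminorm 0 S (X (of_real (inverse (real (Suc n)))) 0) < 1"
      by (rule cont[OF _ S]) (simp add: norm_inverse del: of_nat_Suc, rule LIMSEQ_inverse_real_of_nat)
    then obtain m where m: "Lstar_seminorm 0 S (X (of_real (inverse (real (Suc m)))) 0) < 1"
      unfolding eventually_sequentially by blast
    define K where "K = real (Suc m)"
    have K: "K > 0" by (simp add: K_def)
    have one_bound: "s_norm 0 (X 1 0 \<xi>) \<le> K" if "\<xi> \<in> S" for \<xi>
    proof -
      have \<xi>: "\<xi> \<in> s_space" using that Ss by blast
      have "ennreal (s_norm 0 (X (of_real (inverse K)) 0 \<xi>)) < ennreal 1"
        using le_less_trans[OF Lstar_seminorm_upper(1)[OF that] m] by (simp add: K_def)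
      then have "s_norm 0 (X (of_real (inverse K)) 0 \<xi>) < 1"
        by (simp add: ennreal_less_iff s_norm_nonneg Lstar_carrier_maps XL \<xi> del: ennreal_1)
      moreover have "s_norm 0 (X (of_real (inverse K)) 0 \<xi>) = inverse K * s_norm 0 (X 1 0 \<xi>)"
        using scale[of "of_real (inverse K)" 1 0] \<xi> K
        by (simp add: s_norm_scale Lstar_carrier_maps XL norm_inverse)
      ultimately have "inverse K * s_norm 0 (X 1 0 \<xi>) < 1" by simp
      then show ?thesis using K by (simp add: field_simps)
    qed
    \<comment> \<open>The products of \<open>u_(-a)\<close> with \<open>u_a\<close> and of 1 with 1
      are both 1, and the adjoints of \<open>X 1 a\<close> and \<open>X 1 0\<close> are
      \<open>X 1 (- a)\<close> and \<open>X 1 0\<close>. Hence the bound for the unit holds for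
      every real frequency.\<close>
    have unitary: "s_norm 0 (X 1 a \<xi>) \<le> K" if "\<xi> \<in> S" for a \<xi>
    proof -
      have \<xi>: "\<xi> \<in> s_space" using that Ss by blast
      have "Lstar_star (X 1 a) (X 1 a \<xi>) = Lstar_star (X 1 0) (X 1 0 \<xi>)"
        using mult[of 1 1 "-a" a, THEN fun_cong, of \<xi>] mult[of 1 1 0 0, THEN fun_cong, of \<xi>] \<xi>
        by (simp add: star)
      then have "s_norm 0 (X 1 a \<xi>) = s_norm 0 (X 1 0 \<xi>)"
        by (intro s_norm_eq_of_star_mult_eq XL \<xi>)
      with one_bound[OF that] show ?thesis by simp
    qed

    \<comment> \<open>The square root of the interpolation bound for \<open>t = exp n\<close>: the
      first term becomes \<open>exp n * (exp (- n) * K)^2 = exp (- n) * K^2\<close>, the second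
      \<open>exp (n / 4)^2 / exp n = exp (- n / 2)\<close>.\<close>
    define b where "b n = sqrt ((exp (- real n) * K\<^sup>2 + exp (- real n / 2)) / 2)" for n
    \<comment> \<open>The factor \<open>exp (- 5 / 4 * n)\<close> beats the growth
      \<open>exp n\<close> of \<open>u_n\<close>, so \<open>cont\<close> will supply
      \<open>small\<close>; returning to \<open>exp (- n)\<close> costs \<open>exp (n / 4)\<close>.
      With \<open>t = exp n\<close> any rate strictly between 1 and 3/2 would serve in place of 5/4.
      The frequency \<open>a\<close> is left free because both \<open>n\<close> and
      \<open>- n\<close> are needed.\<close>
    have main: "s_norm N (X (of_real (exp (- real n))) a \<xi>) \<le> b n"
      if "\<xi> \<in> S" and small: "ennreal (s_norm (2 * N) (X (of_real (exp (- 5 / 4 * real n))) a \<xi>)) < 1" for n a \<xi>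
    proof -
      have \<xi>: "\<xi> \<in> s_space" using that Ss by blast
      define \<eta> where "\<eta> = X (of_real (exp (- real n))) a \<xi>"
      have \<eta>: "\<eta> \<in> s_space" unfolding \<eta>_def by (rule Lstar_carrier_maps[OF XL \<xi>])
      have "s_norm 0 \<eta> = exp (- real n) * s_norm 0 (X 1 a \<xi>)"
        unfolding \<eta>_def using scale[of "of_real (exp (- real n))" 1 a] \<xi>
        by (simp add: s_norm_scale Lstar_carrier_maps XL)
      also have "\<dots> \<le> exp (- real n) * K"
        using unitary[OF that(1)] by (intro mult_left_mono) auto
      finally have 1: "(s_norm 0 \<eta>)\<^sup>2 \<le> (exp (- real n) * K)\<^sup>2"
        by (intro power_mono s_norm_nonneg \<eta>)
      have "X (of_real (exp (- real n))) a = X (of_real (exp (real n / 4)) * of_real (exp (- 5 / 4 * real n))) a"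
        by (simp flip: of_real_mult exp_add)
      then have "s_norm (2 * N) \<eta> = exp (real n / 4) * s_norm (2 * N) (X (of_real (exp (- 5 / 4 * real n))) a \<xi>)"
        unfolding \<eta>_def scale using \<xi> by (simp add: s_norm_scale Lstar_carrier_maps XL)
      also have "s_norm (2 * N) (X (of_real (exp (- 5 / 4 * real n))) a \<xi>) \<le> 1"
        using small by (metis ennreal_1 ennreal_less_iff less_le s_norm_nonneg Lstar_carrier_maps XL \<xi>)
      finally have "s_norm (2 * N) \<eta> \<le> exp (real n / 4)" by simp
      then have 2: "(s_norm (2 * N) \<eta>)\<^sup>2 \<le> (exp (real n / 4))\<^sup>2"
        by (intro power_mono s_norm_nonneg \<eta>)
      have "(s_norm N \<eta>)\<^sup>2 \<le> (exp (real n) * (s_norm 0 \<eta>)\<^sup>2 + (s_norm (2 * N) \<eta>)\<^sup>2 / exp (real n)) / 2"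
        by (rule s_norm_interpolation[OF \<eta>]) simp
      also have "\<dots> \<le> (exp (real n) * (exp (- real n) * K)\<^sup>2 + (exp (real n / 4))\<^sup>2 / exp (real n)) / 2"
        using 1 2 by (intro divide_right_mono add_mono mult_left_mono) auto
      also have "exp (real n) * (exp (- real n) * K)\<^sup>2 = exp (- real n) * K\<^sup>2"
        by (simp add: power2_eq_square exp_minus field_simps)
      also have "(exp (real n / 4))\<^sup>2 / exp (real n) = exp (- real n / 2)"
        by (simp add: power2_eq_square flip: exp_add exp_diff)
      finally show ?thesis unfolding b_def \<eta>_def[symmetric] by (rule real_le_rsqrt)
    qed

    have "\<forall>\<^sub>F n in sequentially. Lstar_seminorm (2 * N) S (X (of_real (exp (- 5 / 4 * real n))) (real n)) < 1"
    proof (rule cont[OF _ S])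
      fix p :: nat
      show "(\<lambda>n. cmod (of_real (exp (- 5 / 4 * real n))) * (1 + \<bar>real n\<bar>) ^ p * exp \<bar>real n\<bar>) \<longlonglongrightarrow> 0"
        unfolding norm_of_real abs_exp_cancel abs_of_nat by real_asymp
    qed
    moreover have "b \<longlonglongrightarrow> 0" unfolding b_def by real_asymp
    then have "\<forall>\<^sub>F n in sequentially. b n < e" using e by (rule order_tendstoD)
    ultimately show "\<forall>\<^sub>F n in sequentially. Lstar_seminorm N S (X (of_real (exp (- real n))) (real n)) < ennreal e"
    proof eventually_elim
      case (elim n)
      have "Lstar_seminorm N S (X (of_real (exp (- real n))) (real n)) \<le> ennreal (b n)"
      proof (rule Lstar_seminorm_leI)
        fix \<xi> assume \<xi>: "\<xi> \<in> S"
        \<comment> \<open>\<open>Lstar_seminorm\<close> also controls the adjoint, and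
          \<open>star\<close> turns \<open>X c n\<close> into \<open>X c (- n)\<close> for real
          \<open>c\<close>. So one smallness statement supplies \<open>main\<close> with both
          frequencies.\<close>
        note le = Lstar_seminorm_upper[OF \<xi>, THEN le_less_trans, OF elim(1)]
        show "ennreal (s_norm N (X (of_real (exp (- real n))) (real n) \<xi>)) \<le> ennreal (b n)"
          by (intro ennreal_leI main[OF \<xi>] le)
        show "ennreal (s_norm N (Lstar_star (X (of_real (exp (- real n))) (real n)) \<xi>)) \<le> ennreal (b n)"
          using le(2) unfolding star complex_cnj_complex_of_real by (intro ennreal_leI main[OF \<xi>])
      qed
      also have "\<dots> < ennreal e" using elim(2) e by (rule ennreal_lessI[rotated])
      finally show ?case .
    qed
  qed

  \<comment> \<open>Transfer back to the disc and contradiction\<close>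
  then have "limitin (subtopology (alg_topology Lstar) B) (\<lambda>n. X (of_real (exp (- real n))) (real n)) (X 0 0) sequentially"
    using XB by (simp add: limitin_subtopology flip: zero)
  then have "limitin (alg_topology A_infty) (\<psi> \<circ> (\<lambda>n. X (of_real (exp (- real n))) (real n))) (\<psi> (X 0 0)) sequentially"
    using hom unfolding homeomorphic_maps_def by (blast intro: continuous_map_limit)
  then show False using not_limitin_exp_fun by (simp add: o_def \<psi>X)
qed

end
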